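(* In the long-run persuasion model described in the context, let $\alpha\ge 1$ be the switching threshold. Suppose that every action is revealing, i.e. $u(\omega^1,a)\neq u(\omega^2,a)$ for every $a\in A$, and let $(S,P)$ be a BP-optimal information structure. Then, for any information structure $(S',P')$ that is not BP-optimal, there exists $\delta'\in(0,1)$ such that for all $\delta\in[\delta',1)$, $$\tilde V_{\alpha,\delta}(\mu_0\mid S,P)\ \ge\ \tilde V_{\alpha,\delta}(\mu_0\mid S',P').$$
   Context: Model. States $\Omega=\{\omega^1,\omega^2\}$, actions $A=\{a^1,a^2\}$, prior $\mu_0$ on $\Omega$; a belief is identified with the probability $\mu$ of $\omega^1$, so $\mu_0$ also denotes $\mu_0(\omega^1)$. The Sender has period utility $v(\omega,a)$ and the Receivers have period utility $u(\omega,a)$. An information structure $(S,P)$ is a finite signal set $S$ with conditional probabilities $p(\omega,s)=\Pr(s\mid\omega)$. The Sender fixes $(S,P)$ once and for all; in each period $t=1,2,\dots$ the state $\omega_t\sim\mu_0$ is drawn i.i.d. and the signal $s_t$ is drawn from $p(\omega_t,\cdot)$, independently across periods. Actions. $a^*(\mu)\in\arg\max_{a\in A}[\mu u(\omega^1,a)+(1-\mu)u(\omega^2,a)]$, ties broken in favour of the Sender. An action $a$ is revealing if $u(\omega^1,a)\ne u(\omega^2,a)$, otherwise non-revealing; it is assumed that at least one action is revealing. Alternative structure. $(S,\hat P)$ is given by $\hat p(\omega,s)=\Pr(s)=\mu_0p(\omega^1,s)+(1-\mu_0)p(\omega^2,s)$ for both $\omega$ (uninformative, same signal distribution as $P$).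 Perceived structure and behaviour. In each period the Receiver has a perceived structure, either $P$ or $\hat P$ (in period 1 it is $P$). On seeing $s_t$ she forms the Bayes posterior under the perceived structure (under $\hat P$ it equals $\mu_0$) and plays $a^*$ of that posterior. The observation $o_t$ is $(s_t,\omega_t)$ if $a_t$ is revealing and $s_t$ if $a_t$ is non-revealing; the history is $h_t=(o_1,\dots,o_{t-1})$. For $Q\in\{P,\hat P\}$ with entries $q$, $l(o_t\mid Q)=\mu_0(\omega_t)q(\omega_t,s_t)$ if $a_t$ is revealing and $l(o_t\mid Q)=\mu_0q(\omega^1,s_t)+(1-\mu_0)q(\omega^2,s_t)$ if it is non-revealing; $l(h_t\mid Q)=\prod_{\tau=1}^{t-1}l(o_\tau\mid Q)$. The Bayes factor is $\lambda(h_t)=l(h_t\mid\hat P)/l(h_t\mid P)$. Switching rule with threshold $\alpha\ge1$. If the perceived structure in period $t-1$ was $P$, it becomes $\hat P$ in period $t$ iff $\lambda(h_t)>\alpha$; if it was $\hat P$, it becomes $P$ in period $t$ iff $1/\lambda(h_t)>\alpha$; otherwise it is unchanged. $A_t^\alpha(P)$ is the set of histories $h_t$ at which the perceived structure in period $t$ is $P$, and $l(A_t^\alpha(P))$ is its probability under the true process generated by $P$. Sender's payoff. $\hat v(\mu)=\mu v(\omega^1,a^*(\mu))+(1-\mu)v(\omega^2,a^*(\mu))$; $V(\mu_0\mid S,P)=\sum_\mu\pi_P(\mu)\hat v(\mu)$, where $\pi_P$ is the distribution of posteriors induced by $P$ and $\mu_0$; $V(\mu_0\mid S,\hat P)=\hat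 v(\mu_0)$. For $\delta\in(0,1)$, $$\tilde V_{\alpha,\delta}(\mu_0\mid S,P)=\sum_{t=1}^\infty\delta^{t-1}\Big[l(A_t^\alpha(P))V(\mu_0\mid S,P)+\big(1-l(A_t^\alpha(P))\big)V(\mu_0\mid S,\hat P)\Big].$$ $(S,P)$ is BP-optimal if it maximizes $V(\mu_0\mid S,P)$ over all information structures. *)

theory Defs
  imports "HOL-Probability.Probability" "HOL-Library.Infinite_Typeclass"
begin

datatype state = W1 | W2
datatype action = A1 | A2

text \<open>
  The prior is a distribution \<open>\<mu>0 :: state pmf\<close>; beliefs are reals, namely the
  probability of \<open>W1\<close>. The conditional signal probability \<open>p(\<omega>, s)\<close> is \<open>pmf (p \<omega>) s\<close>.
\<close>

definition info_structure :: "'s set \<Rightarrow> (state \<Rightarrow> 's pmf) \<Rightarrow> bool" where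
  "info_structure S p \<longleftrightarrow> finite S \<and> (\<forall>\<omega>. set_pmf (p \<omega>) \<subseteq> S)"

definition alternative :: "state pmf \<Rightarrow> (state \<Rightarrow> 's pmf) \<Rightarrow> state \<Rightarrow> 's pmf" where
  "alternative \<mu>0 p = (\<lambda>\<omega>. bind_pmf \<mu>0 p)"

definition signal_prob :: "state pmf \<Rightarrow> (state \<Rightarrow> 's pmf) \<Rightarrow> 's \<Rightarrow> real" where
  "signal_prob \<mu>0 q s = pmf \<mu>0 W1 * pmf (q W1) s + pmf \<mu>0 W2 * pmf (q W2) s"

text \<open>Only meaningful for signals of positive probability; otherwise it is \<open>0 / 0 = 0\<close>.\<close>

definition posterior :: "state pmf \<Rightarrow> (state \<Rightarrow> 's pmf) \<Rightarrow> 's \<Rightarrow> real" where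
  "posterior \<mu>0 q s = pmf \<mu>0 W1 * pmf (q W1) s / signal_prob \<mu>0 q s"

definition exp_utility :: "(state \<Rightarrow> action \<Rightarrow> real) \<Rightarrow> real \<Rightarrow> action \<Rightarrow> real" where
  "exp_utility f \<mu> a = \<mu> * f W1 a + (1 - \<mu>) * f W2 a"

text \<open>
  \<open>astar\<close> maximizes the Sender's expected utility among the maximizers of the
  Receiver's expected utility. Ties that remain after that are resolved arbitrarily.
\<close>

definition receiver_choice ::
  "(state \<Rightarrow> action \<Rightarrow> real) \<Rightarrow> (state \<Rightarrow> action \<Rightarrow> real) \<Rightarrow> (real \<Rightarrow> action) \<Rightarrow> bool" where
  "receiver_choice u v astar \<longleftrightarrow>
     (\<forall>\<mu>\<in>{0..1}. is_arg_max (exp_utility v \<mu>)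
        (is_arg_max (exp_utility u \<mu>) (\<lambda>_. True)) (astar \<mu>))"

definition revealing :: "(state \<Rightarrow> action \<Rightarrow> real) \<Rightarrow> action \<Rightarrow> bool" where
  "revealing u a \<longleftrightarrow> u W1 a \<noteq> u W2 a"

datatype 's obs = SignalState 's state | SignalOnly 's

definition observation :: "(state \<Rightarrow> action \<Rightarrow> real) \<Rightarrow> action \<Rightarrow> state \<Rightarrow> 's \<Rightarrow> 's obs" where
  "observation u a \<omega> s = (if revealing u a then SignalState s \<omega> else SignalOnly s)"

primrec obs_lik :: "state pmf \<Rightarrow> (state \<Rightarrow> 's pmf) \<Rightarrow> 's obs \<Rightarrow> real" where
  "obs_lik \<mu>0 q (SignalState s \<omega>) = pmf \<mu>0 \<omega> * pmf (q \<omega>) s"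
| "obs_lik \<mu>0 q (SignalOnly s) = signal_prob \<mu>0 q s"

definition hist_lik :: "state pmf \<Rightarrow> (state \<Rightarrow> 's pmf) \<Rightarrow> 's obs list \<Rightarrow> real" where
  "hist_lik \<mu>0 q h = prod_list (map (obs_lik \<mu>0 q) h)"

definition bayes_factor :: "state pmf \<Rightarrow> (state \<Rightarrow> 's pmf) \<Rightarrow> 's obs list \<Rightarrow> real" where
  "bayes_factor \<mu>0 p h = hist_lik \<mu>0 (alternative \<mu>0 p) h / hist_lik \<mu>0 p h"

datatype perceived = Original | Alternative

definition switch :: "real \<Rightarrow> perceived \<Rightarrow> real \<Rightarrow> perceived" where
  "switch \<alpha> m bf =
     (case m of
        Original \<Rightarrow> if bf > \<alpha> then Alternative else Original
      | Alternative \<Rightarrow> if 1 / bf > \<alpha> then Original else Alternative)"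

text \<open>
  \<open>perceived_at \<alpha> \<mu>0 p h n\<close> is the perceived structure in period \<open>n + 1\<close>, which
  depends only on the first \<open>n\<close> observations in \<open>h\<close>.
\<close>

primrec perceived_at ::
  "real \<Rightarrow> state pmf \<Rightarrow> (state \<Rightarrow> 's pmf) \<Rightarrow> 's obs list \<Rightarrow> nat \<Rightarrow> perceived" where
  "perceived_at \<alpha> \<mu>0 p h 0 = Original"
| "perceived_at \<alpha> \<mu>0 p h (Suc n) =
     switch \<alpha> (perceived_at \<alpha> \<mu>0 p h n) (bayes_factor \<mu>0 p (take (Suc n) h))"

definition perceived_structure ::
  "real \<Rightarrow> state pmf \<Rightarrow> (state \<Rightarrow> 's pmf) \<Rightarrow> 's obs list \<Rightarrow> state \<Rightarrow> 's pmf" where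
  "perceived_structure \<alpha> \<mu>0 p h =
     (case perceived_at \<alpha> \<mu>0 p h (length h) of
        Original \<Rightarrow> p
      | Alternative \<Rightarrow> alternative \<mu>0 p)"

text \<open>
  Law of the first \<open>n\<close> observations, that is, of the history at the start of period
  \<open>n + 1\<close>. States and signals are always drawn from \<open>\<mu>0\<close> and \<open>p\<close>; the perceived
  structure only affects the action and hence what is observed.
\<close>

primrec history_pmf ::
  "(state \<Rightarrow> action \<Rightarrow> real) \<Rightarrow> (real \<Rightarrow> action) \<Rightarrow> real \<Rightarrow> state pmf \<Rightarrow>
     (state \<Rightarrow> 's pmf) \<Rightarrow> nat \<Rightarrow> 's obs list pmf" where
  "history_pmf u astar \<alpha> \<mu>0 p 0 = return_pmf []"
| "history_pmf u astar \<alpha> \<mu>0 p (Suc n) =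
     bind_pmf (history_pmf u astar \<alpha> \<mu>0 p n) (\<lambda>h.
     bind_pmf \<mu>0 (\<lambda>\<omega>.
     bind_pmf (p \<omega>) (\<lambda>s.
       return_pmf (h @
         [observation u (astar (posterior \<mu>0 (perceived_structure \<alpha> \<mu>0 p h) s)) \<omega> s]))))"

definition original_histories ::
  "real \<Rightarrow> state pmf \<Rightarrow> (state \<Rightarrow> 's pmf) \<Rightarrow> nat \<Rightarrow> 's obs list set" where
  "original_histories \<alpha> \<mu>0 p t =
     {h. length h = t - 1 \<and> perceived_at \<alpha> \<mu>0 p h (t - 1) = Original}"

definition prob_original ::
  "(state \<Rightarrow> action \<Rightarrow> real) \<Rightarrow> (real \<Rightarrow> action) \<Rightarrow> real \<Rightarrow> state pmf \<Rightarrow>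
     (state \<Rightarrow> 's pmf) \<Rightarrow> nat \<Rightarrow> real" where
  "prob_original u astar \<alpha> \<mu>0 p t =
     measure_pmf.prob (history_pmf u astar \<alpha> \<mu>0 p (t - 1)) (original_histories \<alpha> \<mu>0 p t)"

definition vhat :: "(state \<Rightarrow> action \<Rightarrow> real) \<Rightarrow> (real \<Rightarrow> action) \<Rightarrow> real \<Rightarrow> real" where
  "vhat v astar \<mu> = exp_utility v \<mu> (astar \<mu>)"

definition posterior_pmf :: "state pmf \<Rightarrow> (state \<Rightarrow> 's pmf) \<Rightarrow> real pmf" where
  "posterior_pmf \<mu>0 p = map_pmf (posterior \<mu>0 p) (bind_pmf \<mu>0 p)"

definition bp_value ::
  "(state \<Rightarrow> action \<Rightarrow> real) \<Rightarrow> (real \<Rightarrow> action) \<Rightarrow> state pmf \<Rightarrow> (state \<Rightarrow> 's pmf) \<Rightarrow> real" where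
  "bp_value v astar \<mu>0 p =
     (\<Sum>\<mu>\<in>set_pmf (posterior_pmf \<mu>0 p). pmf (posterior_pmf \<mu>0 p) \<mu> * vhat v astar \<mu>)"

text \<open>
  The competing structures use signals from the same type \<open>'s\<close>. Since that type is
  infinite, every finite signal set is represented in it up to renaming, so this is
  optimality among all information structures.
\<close>

definition bp_optimal ::
  "(state \<Rightarrow> action \<Rightarrow> real) \<Rightarrow> (real \<Rightarrow> action) \<Rightarrow> state pmf \<Rightarrow>
     ('s::infinite) set \<Rightarrow> (state \<Rightarrow> 's pmf) \<Rightarrow> bool" where
  "bp_optimal v astar \<mu>0 S p \<longleftrightarrow> info_structure S p \<and>
     (\<forall>(T :: 's set) q. info_structure T q \<longrightarrow> bp_value v astar \<mu>0 q \<le> bp_value v astar \<mu>0 p)"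

text \<open>
  The summation index \<open>n\<close> is \<open>t - 1\<close>. The value of the alternative structure is
  \<open>vhat\<close> at the prior, as all its posteriors equal the prior.
\<close>

definition long_run_value ::
  "(state \<Rightarrow> action \<Rightarrow> real) \<Rightarrow> (state \<Rightarrow> action \<Rightarrow> real) \<Rightarrow> (real \<Rightarrow> action) \<Rightarrow>
     real \<Rightarrow> real \<Rightarrow> state pmf \<Rightarrow> (state \<Rightarrow> 's pmf) \<Rightarrow> real" where
  "long_run_value u v astar \<alpha> \<delta> \<mu>0 p =
     (\<Sum>n. \<delta> ^ n *
        (prob_original u astar \<alpha> \<mu>0 p (Suc n) * bp_value v astar \<mu>0 p
         + (1 - prob_original u astar \<alpha> \<mu>0 p (Suc n)) * vhat v astar (pmf \<mu>0 W1)))"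

end

theory Submission
  imports Defs
begin

text \<open>
  When every action is revealing, the square root of the Bayes factor has mean \<open>\<rho> ^ n\<close> after
  \<open>n\<close> periods under the true process, where \<open>\<rho>\<close> is the Bhattacharyya coefficient of the joint laws
  of state and signal under \<open>P\<close> and \<open>\<hat>P\<close>. If \<open>P\<close> is informative then \<open>\<rho> < 1\<close>, so by Markov's
  inequality the Bayes factor falls below \<open>1/\<alpha>\<close> with probability tending to one, and there the
  switching rule selects \<open>P\<close> whatever was perceived before. Hence a BP-optimal structure that is
  strictly better than no information earns its static value in the limit. A competitor earns in
  each period a mixture of two smaller values, so it loses for patient Senders. If the
  BP-optimal value equals the value of no information, the comparison holds period by period.
\<close>

section \<open>Two-point priors and structures that carry no information\<close>

lemma UNIV_state: "(UNIV :: state set) = {W1, W2}"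
  using state.exhaust by auto

lemma pmf_state_sum: "pmf \<mu>0 W1 + pmf \<mu>0 W2 = 1"
  using sum_pmf_eq_1[of "{W1, W2}" \<mu>0] UNIV_state by fastforce

lemma signal_prob_eq_pmf_bind: "signal_prob \<mu>0 p s = pmf (bind_pmf \<mu>0 p) s"
  unfolding signal_prob_def pmf_bind
  by (subst integral_measure_pmf_real[of "{W1, W2}"]) (auto intro: state.exhaust simp: mult.commute)

text \<open>Every signal that occurs leaves the belief at the prior, so the posterior law is a point
  mass. Only states in the support of \<open>\<mu>0\<close> are constrained; if \<open>W1\<close>
  lies outside it, prior and posterior are both 0 whatever \<open>p W1\<close> is. The
  contrapositive later yields a state at which \<open>p\<close> is informative.\<close>

lemma bp_value_uninformative:
  assumes "\<And>\<omega>. \<omega> \<in> set_pmf \<mu>0 \<Longrightarrow> p \<omega> = bind_pmf \<mu>0 p"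
  shows "bp_value v astar \<mu>0 p = vhat v astar (pmf \<mu>0 W1)"
proof -
  have "posterior \<mu>0 p s = pmf \<mu>0 W1" if "s \<in> set_pmf (bind_pmf \<mu>0 p)" for s
  proof (cases "pmf \<mu>0 W1 = 0")
    case False
    then have "p W1 = bind_pmf \<mu>0 p" using assms by (simp add: set_pmf_iff)
    moreover have "pmf (bind_pmf \<mu>0 p) s \<noteq> 0"
      using that by (simp only: set_pmf_iff) simp
    ultimately show ?thesis by (simp add: posterior_def signal_prob_eq_pmf_bind)
  qed (simp add: posterior_def)
  then have "posterior_pmf \<mu>0 p = map_pmf (\<lambda>_. pmf \<mu>0 W1) (bind_pmf \<mu>0 p)"
    unfolding posterior_pmf_def by (intro map_pmf_cong) auto
  then show ?thesis by (simp add: bp_value_def map_pmf_const)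
qed

text \<open>A structure that always sends one fixed signal is an admissible competitor and earns the
  no-information value.\<close>

lemma bp_optimal_ge_uninformative:
  assumes "bp_optimal v astar \<mu>0 (S :: 's::infinite set) p"
  shows "vhat v astar (pmf \<mu>0 W1) \<le> bp_value v astar \<mu>0 p"
proof -
  fix s0 :: 's
  define q where "q = (\<lambda>_::state. return_pmf s0)"
  have "info_structure {s0} q" by (simp add: info_structure_def q_def)
  moreover have "bp_value v astar \<mu>0 q = vhat v astar (pmf \<mu>0 W1)"
    by (rule bp_value_uninformative) (simp add: q_def)
  ultimately show ?thesis using assms unfolding bp_optimal_def by metis
qed

section \<open>Bhattacharyya coefficients\<close>

text \<open>Termwise AM-GM: the geometric means are dominated by arithmetic means that sum to 1,
  strictly at any point where the two laws differ.\<close>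

lemma bhattacharyya:
  fixes x y :: "'a pmf"
  assumes "finite S" "set_pmf x \<subseteq> S" "set_pmf y \<subseteq> S"
  shows bhattacharyya_le_1: "(\<Sum>s\<in>S. sqrt (pmf x s * pmf y s)) \<le> 1"
    and bhattacharyya_less_1: "x \<noteq> y \<Longrightarrow> (\<Sum>s\<in>S. sqrt (pmf x s * pmf y s)) < 1"
proof -
  let ?m = "\<lambda>s. (pmf x s + pmf y s) / 2"
  have one: "(\<Sum>s\<in>S. ?m s) = 1"
    using assms by (simp add: sum_divide_distrib[symmetric] sum.distrib sum_pmf_eq_1)
  have le: "sqrt (pmf x s * pmf y s) \<le> ?m s" for s
    by (rule arith_geo_mean_sqrt) auto
  then show "(\<Sum>s\<in>S. sqrt (pmf x s * pmf y s)) \<le> 1"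
    using one sum_mono[of S "\<lambda>s. sqrt (pmf x s * pmf y s)" ?m] by simp
  assume "x \<noteq> y"
  then obtain s where s: "pmf x s \<noteq> pmf y s" by (meson pmf_eqI)
  then have "s \<in> S" using assms by (metis pmf_eq_0_set_pmf subsetD)
  have "0 < (sqrt (pmf x s) - sqrt (pmf y s))\<^sup>2" using s by simp
  then have "sqrt (pmf x s * pmf y s) < ?m s"
    by (simp add: power2_diff real_sqrt_mult)
  then have "(\<Sum>s\<in>S. sqrt (pmf x s * pmf y s)) < (\<Sum>s\<in>S. ?m s)"
    using le \<open>s \<in> S\<close> \<open>finite S\<close> by (intro sum_strict_mono_ex1) auto
  then show "(\<Sum>s\<in>S. sqrt (pmf x s * pmf y s)) < 1" using one by simp
qed

text \<open>This is the coefficient \<rho> between the joint laws of state and signal under the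
  alternative and the true structure; the common prior factor has been taken out of the square
  root.\<close>

definition affinity :: "state pmf \<Rightarrow> 's set \<Rightarrow> (state \<Rightarrow> 's pmf) \<Rightarrow> real" where
  "affinity \<mu>0 S p =
     (\<Sum>\<omega>\<in>{W1, W2}. pmf \<mu>0 \<omega> * (\<Sum>s\<in>S. sqrt (pmf (bind_pmf \<mu>0 p) s * pmf (p \<omega>) s)))"

lemma affinity_nonneg: "affinity \<mu>0 S p \<ge> 0"
  unfolding affinity_def by (intro sum_nonneg mult_nonneg_nonneg) auto

lemma affinity_less_1:
  assumes "info_structure S p" "\<omega> \<in> set_pmf \<mu>0" "p \<omega> \<noteq> bind_pmf \<mu>0 p"
  shows "affinity \<mu>0 S p < 1"
proof -
  let ?b = "\<lambda>\<omega>. \<Sum>s\<in>S. sqrt (pmf (bind_pmf \<mu>0 p) s * pmf (p \<omega>) s)"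
  have S: "finite S" "set_pmf (bind_pmf \<mu>0 p) \<subseteq> S" "set_pmf (p \<omega>) \<subseteq> S" for \<omega>
    using assms(1) by (auto simp: info_structure_def)
  have "pmf \<mu>0 \<omega>' * ?b \<omega>' \<le> pmf \<mu>0 \<omega>'" for \<omega>'
    using bhattacharyya_le_1[OF S] by (intro mult_left_le) auto
  moreover have "pmf \<mu>0 \<omega> * ?b \<omega> < pmf \<mu>0 \<omega> * 1"
    using bhattacharyya_less_1[OF S] assms(2,3) by (intro mult_strict_left_mono) (auto simp: pmf_positive)
  moreover have "\<omega> \<in> {W1, W2}" using UNIV_state by blast
  ultimately have "affinity \<mu>0 S p < (\<Sum>\<omega>\<in>{W1, W2}. pmf \<mu>0 \<omega>)"
    unfolding affinity_def by (intro sum_strict_mono_ex1) auto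
  then show ?thesis using pmf_state_sum[of \<mu>0] by simp
qed

section \<open>The Bayes factor along random histories\<close>

lemma bayes_factor_nonneg: "bayes_factor \<mu>0 p h \<ge> 0"
proof -
  have "hist_lik \<mu>0 q h \<ge> 0" for q :: "state \<Rightarrow> 'a pmf"
  proof -
    have "obs_lik \<mu>0 q x \<ge> 0" for x by (cases x) (auto simp: signal_prob_def)
    then show ?thesis unfolding hist_lik_def by (induction h) auto
  qed
  then show ?thesis by (simp add: bayes_factor_def)
qed

lemma bayes_factor_snoc_SignalState:
  "bayes_factor \<mu>0 p (h @ [SignalState s \<omega>]) =
     bayes_factor \<mu>0 p h * (pmf \<mu>0 \<omega> * pmf (bind_pmf \<mu>0 p) s / (pmf \<mu>0 \<omega> * pmf (p \<omega>) s))"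
  by (simp add: bayes_factor_def hist_lik_def alternative_def)

text \<open>Once every action reveals the state, the observation no longer depends on the perceived
  structure, so observations are i.i.d.\<close>

lemma history_pmf_Suc_revealing:
  assumes "\<forall>a. revealing u a"
  shows "history_pmf u astar \<alpha> \<mu>0 p (Suc n) =
    bind_pmf (history_pmf u astar \<alpha> \<mu>0 p n) (\<lambda>h.
      bind_pmf \<mu>0 (\<lambda>\<omega>. bind_pmf (p \<omega>) (\<lambda>s. return_pmf (h @ [SignalState s \<omega>]))))"
  using assms by (simp add: observation_def)

text \<open>A signal drawn from \<open>p \<omega>\<close> with \<omega> in the support of the prior
  also has positive mixture probability. Positivity matters because \<open>1 / 0 = 0\<close> would
  block the switch back to \<open>Original\<close>.\<close>

lemma set_history_pmf:
  assumes "\<forall>a. revealing u a" "h \<in> set_pmf (history_pmf u astar \<alpha> \<mu>0 p n)"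
  shows "length h = n \<and> bayes_factor \<mu>0 p h > 0"
  using assms(2)
proof (induction n arbitrary: h)
  case 0
  then show ?case by (simp add: bayes_factor_def hist_lik_def)
next
  case (Suc n)
  from Suc.prems obtain h' \<omega> s where h': "h' \<in> set_pmf (history_pmf u astar \<alpha> \<mu>0 p n)"
    and \<omega>: "\<omega> \<in> set_pmf \<mu>0" and s: "s \<in> set_pmf (p \<omega>)" and h: "h = h' @ [SignalState s \<omega>]"
    unfolding history_pmf_Suc_revealing[OF assms(1)] by auto
  have "s \<in> set_pmf (bind_pmf \<mu>0 p)" using \<omega> s by auto
  then have "pmf (bind_pmf \<mu>0 p) s > 0" by (rule pmf_positive)
  then show ?case using Suc.IH[OF h'] pmf_positive[OF \<omega>] pmf_positive[OF s]
    unfolding h bayes_factor_snoc_SignalState by simp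
qed

text \<open>Weighting the root of a likelihood ratio by its denominator gives the root of the
  product of the two likelihoods.\<close>

lemma nn_integral_sqrt_likelihood_ratio:
  assumes "info_structure S p"
  shows "(\<integral>\<^sup>+\<omega>. \<integral>\<^sup>+s. ennreal (sqrt (pmf \<mu>0 \<omega> * pmf (bind_pmf \<mu>0 p) s / (pmf \<mu>0 \<omega> * pmf (p \<omega>) s)))
           \<partial>measure_pmf (p \<omega>) \<partial>measure_pmf \<mu>0) = ennreal (affinity \<mu>0 S p)"
proof -
  let ?r = "\<lambda>\<omega> s. sqrt (pmf \<mu>0 \<omega> * pmf (bind_pmf \<mu>0 p) s / (pmf \<mu>0 \<omega> * pmf (p \<omega>) s))"
  have S: "finite S" "set_pmf (p \<omega>) \<subseteq> S" for \<omega>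
    using assms by (auto simp: info_structure_def)
  have "(\<integral>\<^sup>+s. ennreal (?r \<omega> s) \<partial>measure_pmf (p \<omega>)) = ennreal (\<Sum>s\<in>S. ?r \<omega> s * pmf (p \<omega>) s)" for \<omega>
  proof -
    have "(\<integral>\<^sup>+s. ennreal (?r \<omega> s) \<partial>measure_pmf (p \<omega>)) = (\<Sum>s\<in>S. ennreal (?r \<omega> s) * pmf (p \<omega>) s)"
      using S by (intro nn_integral_measure_pmf_support) auto
    then show ?thesis by (simp add: ennreal_mult'' sum_ennreal[symmetric])
  qed
  then have "(\<integral>\<^sup>+\<omega>. \<integral>\<^sup>+s. ennreal (?r \<omega> s) \<partial>measure_pmf (p \<omega>) \<partial>measure_pmf \<mu>0) =
      (\<Sum>\<omega>\<in>{W1, W2}. ennreal (\<Sum>s\<in>S. ?r \<omega> s * pmf (p \<omega>) s) * pmf \<mu>0 \<omega>)"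
    by (simp only:, intro nn_integral_measure_pmf_support) (auto intro: state.exhaust)
  also have "\<dots> = ennreal (\<Sum>\<omega>\<in>{W1, W2}. (\<Sum>s\<in>S. ?r \<omega> s * pmf (p \<omega>) s) * pmf \<mu>0 \<omega>)"
    by (simp add: ennreal_mult'' sum_nonneg)
  also have "(\<Sum>\<omega>\<in>{W1, W2}. (\<Sum>s\<in>S. ?r \<omega> s * pmf (p \<omega>) s) * pmf \<mu>0 \<omega>) = affinity \<mu>0 S p"
  proof -
    \<comment> \<open>The case \<open>b = 0\<close> covers signals that \<open>p \<omega>\<close>
      never sends, where division by zero makes both sides 0.\<close>
    have sq: "b * sqrt (a / b) = sqrt (b * a)" if "b \<ge> 0" for a b :: real
      using that by (cases "b = 0") (auto simp: real_sqrt_divide real_sqrt_mult field_simps)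
    have "(\<Sum>s\<in>S. ?r \<omega> s * pmf (p \<omega>) s) * pmf \<mu>0 \<omega> =
        pmf \<mu>0 \<omega> * (\<Sum>s\<in>S. sqrt (pmf (bind_pmf \<mu>0 p) s * pmf (p \<omega>) s))" for \<omega>
      by (cases "pmf \<mu>0 \<omega> = 0") (simp_all add: sq mult.commute)
    then show ?thesis unfolding affinity_def by (intro sum.cong) auto
  qed
  finally show ?thesis .
qed

text \<open>Each new observation multiplies the root by a factor whose mean, \<rho>, is the same
  after every history.\<close>

lemma nn_integral_sqrt_bayes_factor:
  assumes "\<forall>a. revealing u a" "info_structure S p"
  shows "(\<integral>\<^sup>+h. ennreal (sqrt (bayes_factor \<mu>0 p h)) \<partial>measure_pmf (history_pmf u astar \<alpha> \<mu>0 p n)) =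
    ennreal (affinity \<mu>0 S p ^ n)"
proof (induction n)
  case 0
  then show ?case by (simp add: bayes_factor_def hist_lik_def)
next
  case (Suc n)
  let ?r = "\<lambda>\<omega> s. sqrt (pmf \<mu>0 \<omega> * pmf (bind_pmf \<mu>0 p) s / (pmf \<mu>0 \<omega> * pmf (p \<omega>) s))"
  have "ennreal (sqrt (bayes_factor \<mu>0 p (h @ [SignalState s \<omega>]))) =
      ennreal (sqrt (bayes_factor \<mu>0 p h)) * ennreal (?r \<omega> s)" for h s \<omega>
    unfolding bayes_factor_snoc_SignalState real_sqrt_mult[of "bayes_factor \<mu>0 p h"]
    by (rule ennreal_mult'') auto
  then have "(\<integral>\<^sup>+h. ennreal (sqrt (bayes_factor \<mu>0 p h)) \<partial>measure_pmf (history_pmf u astar \<alpha> \<mu>0 p (Suc n))) =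
      (\<integral>\<^sup>+h. ennreal (sqrt (bayes_factor \<mu>0 p h)) *
         (\<integral>\<^sup>+\<omega>. \<integral>\<^sup>+s. ennreal (?r \<omega> s) \<partial>measure_pmf (p \<omega>) \<partial>measure_pmf \<mu>0)
       \<partial>measure_pmf (history_pmf u astar \<alpha> \<mu>0 p n))"
    unfolding history_pmf_Suc_revealing[OF assms(1)] by (simp add: nn_integral_cmult)
  also have "\<dots> = ennreal (affinity \<mu>0 S p ^ n) * ennreal (affinity \<mu>0 S p)"
    unfolding nn_integral_sqrt_likelihood_ratio[OF assms(2)] by (simp add: nn_integral_multc Suc.IH)
  also have "\<dots> = ennreal (affinity \<mu>0 S p ^ Suc n)"
    using affinity_nonneg[of \<mu>0 S p] by (simp add: ennreal_mult''[symmetric] mult.commute)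
  finally show ?case .
qed

section \<open>The true structure is eventually perceived with high probability\<close>

lemma switch_eq_Original:
  assumes "\<alpha> \<ge> 1" "0 < bf" "bf < 1 / \<alpha>"
  shows "switch \<alpha> m bf = Original"
proof -
  have "1 / \<alpha> \<le> 1" using assms(1) by simp
  then have "bf \<le> \<alpha>" using assms by linarith
  moreover have "1 / bf > \<alpha>" using assms by (simp add: field_simps)
  ultimately show ?thesis by (cases m) (auto simp: switch_def)
qed

text \<open>Markov's inequality for the root of the Bayes factor. Period \<open>Suc (Suc n)\<close>
  follows \<open>Suc n\<close> observations, so the last application of the switching rule decides
  the perceived structure.\<close>

lemma prob_original_ge:
  assumes "\<forall>a. revealing u a" "info_structure S p" "\<alpha> \<ge> 1"
  shows "prob_original u astar \<alpha> \<mu>0 p (Suc (Suc n)) \<ge> 1 - sqrt \<alpha> * affinity \<mu>0 S p ^ Suc n"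
proof -
  let ?M = "history_pmf u astar \<alpha> \<mu>0 p (Suc n)"
  \<comment> \<open>The bad event that the Bayes factor is at least \<open>1 / \<alpha>\<close>, in
    the form that Markov's inequality expects.\<close>
  let ?B = "{h. 1 \<le> ennreal (sqrt \<alpha>) * ennreal (sqrt (bayes_factor \<mu>0 p h))}"
  have "emeasure (measure_pmf ?M) (?B \<inter> UNIV) \<le>
      ennreal (sqrt \<alpha>) * (\<integral>\<^sup>+h. ennreal (sqrt (bayes_factor \<mu>0 p h)) * indicator UNIV h \<partial>measure_pmf ?M)"
    using nn_integral_Markov_inequality[of "\<lambda>h. ennreal (sqrt (bayes_factor \<mu>0 p h))" UNIV
        "measure_pmf ?M" "ennreal (sqrt \<alpha>)"] by (simp del: history_pmf.simps)
  then have "emeasure (measure_pmf ?M) ?B \<le> ennreal (sqrt \<alpha>) * ennreal (affinity \<mu>0 S p ^ Suc n)"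
    using nn_integral_sqrt_bayes_factor[OF assms(1,2)] by (simp del: history_pmf.simps power_Suc)
  also have "\<dots> = ennreal (sqrt \<alpha> * affinity \<mu>0 S p ^ Suc n)"
    by (rule ennreal_mult''[symmetric]) (use affinity_nonneg[of \<mu>0 S p] in simp)
  finally have B: "measure_pmf.prob ?M ?B \<le> sqrt \<alpha> * affinity \<mu>0 S p ^ Suc n"
    using affinity_nonneg[of \<mu>0 S p] assms(3) by (simp add: measure_pmf.emeasure_eq_measure)
  have "h \<in> original_histories \<alpha> \<mu>0 p (Suc (Suc n))"
    if h: "h \<in> set_pmf ?M" "h \<notin> ?B" for h
  proof -
    have l: "length h = Suc n" and pos: "bayes_factor \<mu>0 p h > 0"
      using set_history_pmf[OF assms(1) h(1)] by auto
    have "sqrt (\<alpha> * bayes_factor \<mu>0 p h) < 1"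
      using h(2) assms(3) by (simp add: ennreal_mult''[symmetric] bayes_factor_nonneg not_le real_sqrt_mult)
    then have "bayes_factor \<mu>0 p h < 1 / \<alpha>" using assms(3) by (simp add: field_simps)
    then show ?thesis
      using l switch_eq_Original[OF assms(3) pos] by (simp add: original_histories_def)
  qed
  \<comment> \<open>The inclusion holds only on the support of the history law, hence almost
    everywhere.\<close>
  then have "measure_pmf.prob ?M (- ?B) \<le> measure_pmf.prob ?M (original_histories \<alpha> \<mu>0 p (Suc (Suc n)))"
    by (intro measure_pmf.finite_measure_mono_AE) (auto simp: AE_measure_pmf_iff)
  moreover have "measure_pmf.prob ?M (- ?B) = 1 - measure_pmf.prob ?M ?B"
    using measure_pmf.prob_compl[of ?B ?M] by (simp add: Compl_eq_Diff_UNIV)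
  ultimately show ?thesis using B by (simp add: prob_original_def)
qed

lemma prob_original_in_01: "prob_original u astar \<alpha> \<mu>0 p t \<in> {0..1}"
  by (simp add: prob_original_def)

lemma prob_original_tendsto_1:
  assumes "\<forall>a. revealing u a" "info_structure S p" "\<alpha> \<ge> 1"
    and "\<omega> \<in> set_pmf \<mu>0" "p \<omega> \<noteq> bind_pmf \<mu>0 p"
  shows "(\<lambda>n. prob_original u astar \<alpha> \<mu>0 p (Suc n)) \<longlonglongrightarrow> 1"
proof -
  have "(\<lambda>n. 1 - sqrt \<alpha> * affinity \<mu>0 S p ^ Suc n) \<longlonglongrightarrow> 1 - sqrt \<alpha> * 0"
    using affinity_nonneg[of \<mu>0 S p] affinity_less_1[OF assms(2,4,5)]
    by (intro tendsto_intros LIMSEQ_Suc LIMSEQ_realpow_zero) auto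
  then have "(\<lambda>n. prob_original u astar \<alpha> \<mu>0 p (Suc (Suc n))) \<longlonglongrightarrow> 1"
    using prob_original_ge[OF assms(1-3)] prob_original_in_01[of u astar \<alpha> \<mu>0 p]
    by (intro tendsto_sandwich[of "\<lambda>n. 1 - sqrt \<alpha> * affinity \<mu>0 S p ^ Suc n"
          "\<lambda>n. prob_original u astar \<alpha> \<mu>0 p (Suc (Suc n))" sequentially "\<lambda>_. 1"]) auto
  then show ?thesis by (rule LIMSEQ_imp_Suc)
qed

section \<open>Discounted sums for a patient Sender\<close>

lemma summable_geometric_times_bounded:
  fixes d :: "nat \<Rightarrow> real"
  assumes "\<And>n. \<bar>d n\<bar> \<le> B" "0 < \<delta>" "\<delta> < 1"
  shows "summable (\<lambda>n. \<delta> ^ n * d n)"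
proof (rule summable_comparison_test')
  show "summable (\<lambda>n. \<delta> ^ n * B)" using assms by (intro summable_mult2 summable_geometric) auto
  show "norm (\<delta> ^ n * d n) \<le> \<delta> ^ n * B" for n
    using assms by (simp add: abs_mult mult_left_mono)
qed

text \<open>A constant stream \<open>c\<close> is worth \<open>c / (1 - \<delta>)\<close>, which
  grows without bound as \<delta> tends to 1, while the first \<open>N\<close> periods fall short of
  it by a bounded total.\<close>

lemma discounted_sum_eventually_nonneg:
  fixes d :: "nat \<Rightarrow> real"
  assumes bd: "\<And>n. \<bar>d n\<bar> \<le> B" and "c > 0" and ev: "eventually (\<lambda>n. d n \<ge> c) sequentially"
  shows "\<exists>\<delta>'\<in>{0<..<1}. \<forall>\<delta>\<in>{\<delta>'..<1}. 0 \<le> (\<Sum>n. \<delta> ^ n * d n)"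
proof -
  obtain N where N: "\<And>n. n \<ge> N \<Longrightarrow> d n \<ge> c" using ev by (auto simp: eventually_sequentially)
  have "B \<ge> 0" using bd[of 0] by linarith
  define K where "K = (c + B) * N"
  have "K \<ge> 0" using \<open>B \<ge> 0\<close> \<open>c > 0\<close> by (simp add: K_def)
  \<comment> \<open>Chosen so that \<open>K * (1 - \<delta>) \<le> c\<close> from \<delta>' on;
    \<open>2 * c\<close> in place of \<open>c\<close> keeps \<delta>' positive even if
    \<open>K = 0\<close>.\<close>
  define \<delta>' where "\<delta>' = 1 - c / (K + 2 * c)"
  have "\<delta>' \<in> {0<..<1}" using \<open>K \<ge> 0\<close> \<open>c > 0\<close> by (simp add: \<delta>'_def field_simps)
  moreover have "0 \<le> (\<Sum>n. \<delta> ^ n * d n)" if \<delta>: "\<delta> \<in> {\<delta>'..<1}" for \<delta>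
  proof -
    have \<delta>01: "0 < \<delta>" "\<delta> < 1" using \<delta> \<open>\<delta>' \<in> {0<..<1}\<close> by auto
    let ?g = "\<lambda>n. if n \<in> {..<N} then - (c + B) else 0"
    have g: "?g sums (\<Sum>n<N. - (c + B))" by (rule sums_If_finite_set) simp
    have geo: "(\<lambda>n. \<delta> ^ n * c) sums (1 / (1 - \<delta>) * c)"
      using \<delta>01 by (intro sums_mult2 geometric_sums) auto
    \<comment> \<open>The early shortfall \<open>c + B\<close> is charged without discounting, so
      the bound on it does not depend on \<delta>.\<close>
    have le: "\<delta> ^ n * c + ?g n \<le> \<delta> ^ n * d n" for n
    proof (cases "n < N")
      case True
      have "\<delta> ^ n * (c - d n) \<le> \<delta> ^ n * (c + B)"
        using bd[of n] \<delta>01 by (intro mult_left_mono) auto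
      also have "\<dots> \<le> c + B"
        using \<delta>01 \<open>c > 0\<close> \<open>B \<ge> 0\<close> by (intro mult_left_le_one_le) (auto simp: power_le_one)
      finally show ?thesis using True by (simp add: algebra_simps)
    next
      case False
      then show ?thesis using N[of n] \<delta>01 by simp
    qed
    have "1 / (1 - \<delta>) * c + (\<Sum>n<N. - (c + B)) \<le> (\<Sum>n. \<delta> ^ n * d n)"
      by (rule sums_le[OF le sums_add[OF geo g]])
        (rule summable_sums[OF summable_geometric_times_bounded[OF bd \<delta>01]])
    moreover have "K \<le> 1 / (1 - \<delta>) * c"
    proof -
      have "K * (1 - \<delta>) \<le> K * (c / (K + 2 * c))"
        using \<delta> \<open>K \<ge> 0\<close> by (intro mult_left_mono) (auto simp: \<delta>'_def)
      also have "\<dots> \<le> c" using \<open>K \<ge> 0\<close> \<open>c > 0\<close> by (simp add: field_simps)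
      finally show ?thesis using \<delta>01 by (simp add: field_simps)
    qed
    ultimately show ?thesis by (simp add: K_def algebra_simps)
  qed
  ultimately show ?thesis by blast
qed

theorem proposition1:
  fixes u v :: "state \<Rightarrow> action \<Rightarrow> real"
    and astar :: "real \<Rightarrow> action"
    and \<mu>0 :: "state pmf"
    and \<alpha> :: real
    and S S' :: "('s::infinite) set"
    and p p' :: "state \<Rightarrow> 's pmf"
  assumes "receiver_choice u v astar"
    and "\<alpha> \<ge> 1"
    and "\<forall>a. revealing u a"
    and "bp_optimal v astar \<mu>0 S p"
    and "info_structure S' p'"
    and "\<not> bp_optimal v astar \<mu>0 S' p'"
  shows "\<exists>\<delta>'\<in>{0<..<1}. \<forall>\<delta>\<in>{\<delta>'..<1}.
           long_run_value u v astar \<alpha> \<delta> \<mu>0 p \<ge> long_run_value u v astar \<alpha> \<delta> \<mu>0 p'"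
proof -
  let ?V = "bp_value v astar \<mu>0 p" and ?V' = "bp_value v astar \<mu>0 p'"
    and ?v0 = "vhat v astar (pmf \<mu>0 W1)"
  let ?q = "\<lambda>n. prob_original u astar \<alpha> \<mu>0 p (Suc n)"
    and ?q' = "\<lambda>n. prob_original u astar \<alpha> \<mu>0 p' (Suc n)"
  \<comment> \<open>The difference of the two payoffs in period \<open>n + 1\<close>, after the
    common term \<open>?v0\<close> cancels.\<close>
  define d where "d n = ?q n * (?V - ?v0) - ?q' n * (?V' - ?v0)" for n
  have S: "info_structure S p" using assms(4) by (simp add: bp_optimal_def)
  have v0: "?v0 \<le> ?V" using bp_optimal_ge_uninformative[OF assms(4)] .
  \<comment> \<open>As \<open>p'\<close> is an information structure, it can fail optimality only by
    being strictly beaten.\<close>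
  have V': "?V' < ?V"
  proof -
    obtain T :: "'s set" and q where "info_structure T q" "?V' < bp_value v astar \<mu>0 q"
      using assms(5,6) unfolding bp_optimal_def by (auto simp: not_le)
    moreover from this have "bp_value v astar \<mu>0 q \<le> ?V"
      using assms(4) unfolding bp_optimal_def by blast
    ultimately show ?thesis by simp
  qed
  have q: "0 \<le> ?q n" "?q n \<le> 1" "0 \<le> ?q' n" "?q' n \<le> 1" for n
    using prob_original_in_01 by (auto simp: prob_original_def)
  have mix: "\<bar>x * a + (1 - x) * b\<bar> \<le> \<bar>a\<bar> + \<bar>b\<bar>" if "0 \<le> x" "x \<le> 1" for x a b :: real
  proof -
    have "\<bar>x * a\<bar> \<le> \<bar>a\<bar>" "\<bar>(1 - x) * b\<bar> \<le> \<bar>b\<bar>"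
      using that by (auto simp: abs_mult intro!: mult_left_le_one_le)
    then show ?thesis by linarith
  qed
  have diff: "long_run_value u v astar \<alpha> \<delta> \<mu>0 p - long_run_value u v astar \<alpha> \<delta> \<mu>0 p' =
      (\<Sum>n. \<delta> ^ n * d n)" if "0 < \<delta>" "\<delta> < 1" for \<delta>
    unfolding long_run_value_def d_def
    by (subst suminf_diff[OF summable_geometric_times_bounded[OF mix]
          summable_geometric_times_bounded[OF mix]])
      (auto intro!: suminf_cong that q simp: algebra_simps)
  have "\<exists>\<delta>'\<in>{0<..<1}. \<forall>\<delta>\<in>{\<delta>'..<1}. 0 \<le> (\<Sum>n. \<delta> ^ n * d n)"
  \<comment> \<open>In the equality case \<open>?V' < ?v0\<close>, so every \<open>d n\<close> is
    nonnegative and any threshold works, such as 1/2.\<close>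
  proof (cases "?V = ?v0")
    case True
    have "d n \<ge> 0" for n
      unfolding d_def using q[of n] V' True by (simp add: mult_nonneg_nonpos)
    moreover have "\<bar>d n\<bar> \<le> \<bar>?V' - ?v0\<bar>" for n
      unfolding d_def using q[of n] True by (simp add: abs_mult mult_left_le_one_le)
    ultimately have "0 \<le> (\<Sum>n. \<delta> ^ n * d n)" if "0 < \<delta>" "\<delta> < 1" for \<delta>
      using that by (intro suminf_nonneg summable_geometric_times_bounded) auto
    then show ?thesis by (intro bexI[of _ "1/2"]) auto
  next
    case False
    then obtain \<omega> where "\<omega> \<in> set_pmf \<mu>0" "p \<omega> \<noteq> bind_pmf \<mu>0 p"
      using bp_value_uninformative by blast
    then have lim: "?q \<longlonglongrightarrow> 1"
      using prob_original_tendsto_1[OF assms(3) S assms(2)] by blast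
    \<comment> \<open>\<open>m\<close> bounds the competitor's gain over no information for every
      \<open>?q' n\<close> in [0,1]. The limiting advantage is then at least \<open>2 * c\<close>;
      halving it leaves room for convergence.\<close>
    define m where "m = max 0 (?V' - ?v0)"
    define c where "c = (?V - ?v0 - m) / 2"
    have "c > 0" using V' v0 False by (auto simp: c_def m_def)
    have "(\<lambda>n. ?q n * (?V - ?v0) - m) \<longlonglongrightarrow> 1 * (?V - ?v0) - m"
      by (intro tendsto_intros lim)
    then have "eventually (\<lambda>n. ?q n * (?V - ?v0) - m > c) sequentially"
      by (rule order_tendstoD) (use \<open>c > 0\<close> in \<open>simp add: c_def\<close>)
    moreover have "d n \<ge> ?q n * (?V - ?v0) - m" for n
    proof -
      have "?q' n * (?V' - ?v0) \<le> ?q' n * m" using q[of n] by (intro mult_left_mono) (auto simp: m_def)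
      also have "\<dots> \<le> m" using q[of n] by (intro mult_left_le_one_le) (auto simp: m_def)
      finally show ?thesis by (simp add: d_def)
    qed
    ultimately have "eventually (\<lambda>n. d n \<ge> c) sequentially"
      by (auto elim!: eventually_mono intro: order_trans less_imp_le)
    moreover have "\<bar>d n\<bar> \<le> \<bar>?V - ?v0\<bar> + \<bar>?V' - ?v0\<bar>" for n
    proof -
      have "\<bar>?q n * (?V - ?v0)\<bar> \<le> \<bar>?V - ?v0\<bar>" "\<bar>?q' n * (?V' - ?v0)\<bar> \<le> \<bar>?V' - ?v0\<bar>"
        using q[of n] by (auto simp: abs_mult intro!: mult_left_le_one_le)
      then show ?thesis unfolding d_def by linarith
    qed
    ultimately show ?thesis using \<open>c > 0\<close> discounted_sum_eventually_nonneg by blast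
  qed
  then obtain \<delta>' where \<delta>': "\<delta>' \<in> {0<..<1}" "\<And>\<delta>. \<delta> \<in> {\<delta>'..<1} \<Longrightarrow> 0 \<le> (\<Sum>n. \<delta> ^ n * d n)"
    by blast
  show ?thesis
  proof (intro bexI[of _ \<delta>'] ballI)
    fix \<delta> assume "\<delta> \<in> {\<delta>'..<1}"
    with \<delta>' diff[of \<delta>] show "long_run_value u v astar \<alpha> \<delta> \<mu>0 p' \<le> long_run_value u v astar \<alpha> \<delta> \<mu>0 p"
      by fastforce
  qed (rule \<delta>'(1))
qed

end
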